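(* Let $\eta,\ell\in\mathbb{R}$ with $\ell>-3/2$, $\ell\neq-1$ and $\eta\neq0$, and let $n\in\mathbb{N}=\{1,2,\dots\}$. If $H\ge0$, then the zeros of the polynomials $R_{n,\ell,\eta}(x)$ and $D_{n,\ell,\eta}(H;x)$ are all simple and real, and the zeros of these two polynomials interlace each other.
   Context: For $\ell>-3/2$, $\ell\ne-1$, $\eta\neq0$, the monic polynomials $R_{n,\ell,\eta}(x)$ ($n\ge0$) are defined by $$R_{0,\ell,\eta}(x)=1,\qquad R_{1,\ell,\eta}(x)=x+\frac{\eta}{2(\ell+1)(\ell+2)},$$ $$R_{n+1,\ell,\eta}(x)=(x-\alpha_n)R_{n,\ell,\eta}(x)-\beta_nR_{n-1,\ell,\eta}(x)\quad(n\ge1),$$ $$\alpha_n=-\frac{\eta}{2(\ell+n+1)(\ell+n+2)},\qquad \beta_n=\frac{(\ell+n+1)^2+\eta^2}{2(2\ell+2n+1)_3(\ell+n+1)},$$ where $(a)_3=a(a+1)(a+2)$. For $H\in\mathbb{R}$ and $n\ge1$, $$D_{n,\ell,\eta}(H;x)=\left(\frac{\eta}{2(\ell+1)}+Hx\right)R_{n,\ell,\eta}(x)-\frac{1+\eta^2/(\ell+1)^2}{4(2\ell+3)}R_{n-1,\ell+1,\eta}(x).$$ Two polynomials with only simple real zeros have interlacing zeros if they have no common zero and between any two consecutive zeros of either one there is exactly one zero of the other. *)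

theory Defs
  imports Complex_Main "HOL-Computational_Algebra.Polynomial"
begin

definition alpha :: "real \<Rightarrow> real \<Rightarrow> nat \<Rightarrow> real" where
  "alpha l \<eta> n = - \<eta> / (2 * (l + real n + 1) * (l + real n + 2))"

definition beta :: "real \<Rightarrow> real \<Rightarrow> nat \<Rightarrow> real" where
  "beta l \<eta> n = ((l + real n + 1)\<^sup>2 + \<eta>\<^sup>2) /
     (2 * pochhammer (2 * l + 2 * real n + 1) 3 * (l + real n + 1))"

fun R :: "nat \<Rightarrow> real \<Rightarrow> real \<Rightarrow> real poly" where
  "R 0 l \<eta> = 1"
| "R (Suc 0) l \<eta> = [:\<eta> / (2 * (l + 1) * (l + 2)), 1:]"
| "R (Suc (Suc n)) l \<eta> =
     [:- alpha l \<eta> (Suc n), 1:] * R (Suc n) l \<eta> - smult (beta l \<eta> (Suc n)) (R n l \<eta>)"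

(* Only meaningful for n \<ge> 1, since n - 1 is truncated subtraction. *)
definition D :: "nat \<Rightarrow> real \<Rightarrow> real \<Rightarrow> real \<Rightarrow> real poly" where
  "D n l \<eta> H = [:\<eta> / (2 * (l + 1)), H:] * R n l \<eta>
     - smult ((1 + \<eta>\<^sup>2 / (l + 1)\<^sup>2) / (4 * (2 * l + 3))) (R (n - 1) (l + 1) \<eta>)"

(* Zeros are taken in the complex plane, so that their reality is a genuine assertion. *)
definition only_simple_real_zeros :: "real poly \<Rightarrow> bool" where
  "only_simple_real_zeros p \<longleftrightarrow> p \<noteq> 0 \<and>
     (\<forall>z::complex. poly (map_poly of_real p) z = 0 \<longrightarrow>
        z \<in> \<real> \<and> order z (map_poly of_real p) = 1)"

definition consecutive_zeros :: "real poly \<Rightarrow> real \<Rightarrow> real \<Rightarrow> bool" where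
  "consecutive_zeros p a b \<longleftrightarrow> a < b \<and> poly p a = 0 \<and> poly p b = 0 \<and>
     (\<forall>t. a < t \<and> t < b \<longrightarrow> poly p t \<noteq> 0)"

definition zeros_interlace :: "real poly \<Rightarrow> real poly \<Rightarrow> bool" where
  "zeros_interlace p q \<longleftrightarrow>
     (\<nexists>x. poly p x = 0 \<and> poly q x = 0) \<and>
     (\<forall>a b. consecutive_zeros p a b \<longrightarrow> (\<exists>!t. a < t \<and> t < b \<and> poly q t = 0)) \<and>
     (\<forall>a b. consecutive_zeros q a b \<longrightarrow> (\<exists>!t. a < t \<and> t < b \<and> poly p t = 0))"

end

theory Submission
  imports Defs
begin

text \<open>
  The idea is to treat \<open>D\<close> as one more link of the continued fraction that generates
  the polynomials \<open>R\<close>. The recurrence coefficients of \<open>R n (l + 1) \<eta>\<close>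
  are those of \<open>R n l \<eta>\<close> shifted by one index, so
  \<open>R n (l + 1) \<eta>\<close> are the associated (numerator) polynomials, and expanding the
  Jacobi matrix along its first instead of its last row gives (lemma \<open>R_first_row\<close>)
  \<open>R (n + 1) l \<eta> = (x - \<alpha>\<^sub>0) R n (l + 1) \<eta> - \<beta>\<^sub>1 R (n - 1) (l + 2) \<eta>\<close>
  with \<open>\<beta>\<^sub>1 > 0\<close>. The definition
  \<open>D n l \<eta> H = (\<eta> / (2 (l + 1)) + H x) R n l \<eta> - c R (n - 1) (l + 1) \<eta>\<close>
  with \<open>c > 0\<close> has the very same shape: the successor of a pair \<open>(q, r)\<close>
  is \<open>p = (a + h x) q - c r\<close> with \<open>h \<ge> 0\<close> and \<open>c > 0\<close>.

  In terms of quotients such a step reads \<open>p / q = a + h x - c / (q / r)\<close>. If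
  \<open>q / r\<close> maps the open upper half-plane into itself and increases on the real line
  between its poles, then so does \<open>p / q\<close>, because \<open>w \<mapsto> - 1 / w\<close>
  has both properties and adding \<open>a + h x\<close> preserves them. Polynomial pairs with such a
  quotient are called Nevanlinna pairs below. Starting from
  \<open>(x - \<alpha>\<^sub>0) / 1\<close>, every quotient of \<open>R n l \<eta>\<close> by
  \<open>R (n - 1) (l + 1) \<eta>\<close> has the property (lemma \<open>nevanlinna_pair_R\<close>),
  and one last step (lemma \<open>nevanlinna_pair_step\<close>) gives it to the quotient of
  \<open>D n l \<eta> H\<close> by \<open>R n l \<eta>\<close>.

  A Nevanlinna pair \<open>(p, q)\<close> has simple, real and interlacing zeros. Neither polynomial
  vanishes off the real line. The Wronskian \<open>p' q - p q'\<close> is positive, so all zeros are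
  simple and there is no common one; and by Rolle's theorem for \<open>p / q\<close> and
  \<open>q / p\<close> each polynomial has a zero strictly between any two zeros of the other. This
  avoids counting zeros against the degree of \<open>D n l \<eta> H\<close>, which is
  \<open>n\<close> if \<open>H = 0\<close> and \<open>n + 1\<close> otherwise.
\<close>

section \<open>Real polynomials on the complex plane\<close>

abbreviation cpoly :: "real poly \<Rightarrow> complex \<Rightarrow> complex" where
  "cpoly p z \<equiv> poly (map_poly of_real p) z"

lemma map_poly_of_real_add:
  "map_poly of_real (p + q) = (map_poly of_real p + map_poly of_real q :: complex poly)"
  by (rule poly_eqI) (simp add: coeff_map_poly)

lemma cpoly_add: "cpoly (p + q) z = cpoly p z + cpoly q z"
  by (simp add: map_poly_of_real_add)

lemma cpoly_pCons: "cpoly (pCons a p) z = of_real a + z * cpoly p z"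
  by (simp add: map_poly_pCons)

lemma cpoly_smult: "cpoly (smult a p) z = of_real a * cpoly p z"
  by (simp add: map_poly_smult)

lemma cpoly_diff: "cpoly (p - q) z = cpoly p z - cpoly q z"
  using cpoly_add[of "p - q" q z] by simp

lemma cpoly_of_real: "cpoly p (of_real x) = of_real (poly p x)"
  by (induction p) (simp_all add: cpoly_pCons)

lemma pderiv_map_poly_of_real:
  "pderiv (map_poly of_real p) = (map_poly of_real (pderiv p) :: complex poly)"
  by (rule poly_eqI) (simp add: coeff_pderiv coeff_map_poly)

lemma cpoly_cnj: "cpoly p (cnj z) = cnj (cpoly p z)"
  by (rule poly_cnj_real[symmetric]) (simp add: coeff_map_poly)

lemma only_simple_real_zerosI:
  assumes upper: "\<And>z. Im z > 0 \<Longrightarrow> cpoly p z \<noteq> 0"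
    and simple: "\<And>x. poly p x = 0 \<Longrightarrow> poly (pderiv p) x \<noteq> 0"
  shows "only_simple_real_zeros p"
  unfolding only_simple_real_zeros_def
proof (intro conjI allI impI)
  show p0: "p \<noteq> 0"
    using upper[of \<i>] by auto
  fix z :: complex
  assume z: "cpoly p z = 0"
  have "Im z = 0"
    using upper[of z] upper[of "cnj z"] z by (force simp: cpoly_cnj)
  then show "z \<in> \<real>"
    by (simp add: complex_is_Real_iff)
  then obtain x where x: "z = of_real x"
    by (auto elim: Reals_cases)
  have "poly p x = 0"
    using z by (simp add: x cpoly_of_real)
  then have "poly (pderiv (map_poly of_real p)) z \<noteq> 0"
    using simple by (simp add: x pderiv_map_poly_of_real cpoly_of_real)
  then have "order z (pderiv (map_poly of_real p)) = 0"
    by (rule order_0I)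
  moreover have "map_poly complex_of_real p \<noteq> 0"
    using p0 by (simp add: map_poly_eq_0_iff)
  ultimately show "order z (map_poly of_real p) = 1"
    using order_pderiv z by fastforce
qed

section \<open>Interlacing from a Wronskian without zeros\<close>

definition wronskian :: "real poly \<Rightarrow> real poly \<Rightarrow> real \<Rightarrow> real" where
  "wronskian p q x = poly (pderiv p) x * poly q x - poly p x * poly (pderiv q) x"

lemma wronskian_swap: "wronskian q p x = - wronskian p q x"
  by (simp add: wronskian_def)

text \<open>If \<open>q\<close> had no zero, then \<open>p / q\<close> would be smooth on the closed interval and zero at both
  ends, so its derivative, the Wronskian over \<open>q\<^sup>2\<close>, would vanish somewhere.\<close>

lemma zero_between_zeros:
  assumes W: "\<And>x. wronskian p q x \<noteq> 0"
    and ab: "a < b" "poly p a = 0" "poly p b = 0"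
  shows "\<exists>t. a < t \<and> t < b \<and> poly q t = 0"
proof (rule ccontr)
  assume no_zero: "\<nexists>t. a < t \<and> t < b \<and> poly q t = 0"
  have q: "poly q x \<noteq> 0" if "a \<le> x" "x \<le> b" for x
  proof (cases "x = a \<or> x = b")
    case True
    then have "poly p x = 0"
      using ab by auto
    then show ?thesis
      using W[of x] by (auto simp: wronskian_def)
  next
    case False
    then show ?thesis
      using no_zero that by (metis order_le_less)
  qed
  define f where "f x = poly p x / poly q x" for x
  have deriv: "(f has_real_derivative wronskian p q x / (poly q x)\<^sup>2) (at x)"
    if "a \<le> x" "x \<le> b" for x
    unfolding f_def wronskian_def power2_eq_square
    by (rule DERIV_divide) (simp_all add: poly_DERIV q[OF that])
  have "\<exists>z. a < z \<and> z < b \<and> (f has_real_derivative 0) (at z)"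
  proof (rule Rolle)
    show "f a = f b"
      by (simp add: f_def ab)
    show "continuous_on {a..b} f"
      by (rule DERIV_continuous_on) (use deriv in \<open>auto intro: has_field_derivative_at_within\<close>)
    show "f differentiable (at x)" if "a < x" "x < b" for x
      using deriv[of x] that real_differentiable_def by auto
  qed (rule ab)
  then obtain z where z: "a < z" "z < b" "(f has_real_derivative 0) (at z)"
    by blast
  then have "wronskian p q z / (poly q z)\<^sup>2 = 0"
    using DERIV_unique deriv[of z] by force
  then show False
    using W[of z] q[of z] z by simp
qed

lemma unique_zero_between_consecutive_zeros:
  assumes W: "\<And>x. wronskian p q x \<noteq> 0"
    and cons: "consecutive_zeros p a b"
  shows "\<exists>!t. a < t \<and> t < b \<and> poly q t = 0"
proof -
  have ab: "a < b" "poly p a = 0" "poly p b = 0"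
    and no_zero: "\<And>t. a < t \<Longrightarrow> t < b \<Longrightarrow> poly p t \<noteq> 0"
    using cons by (auto simp: consecutive_zeros_def)
  have W': "wronskian q p x \<noteq> 0" for x
    using W[of x] by (simp add: wronskian_swap[of q p])
  have not_two: False
    if "a < s" "s < t" "t < b" "poly q s = 0" "poly q t = 0" for s t
    using zero_between_zeros[OF W', of s t] no_zero that by force
  show ?thesis
    using zero_between_zeros[OF W ab] not_two by (metis linorder_neqE)
qed

lemma zeros_interlaceI:
  assumes W: "\<And>x. wronskian p q x \<noteq> 0"
  shows "zeros_interlace p q"
proof -
  have W': "wronskian q p x \<noteq> 0" for x
    using W[of x] by (simp add: wronskian_swap[of q p])
  have "\<nexists>x. poly p x = 0 \<and> poly q x = 0"
    using W by (metis diff_self mult_zero_left mult_zero_right wronskian_def)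
  then show ?thesis
    unfolding zeros_interlace_def
    using unique_zero_between_consecutive_zeros[OF W]
      unique_zero_between_consecutive_zeros[OF W'] by blast
qed

section \<open>Nevanlinna pairs\<close>

text \<open>The second condition says that \<open>p / q\<close> maps the upper half-plane into itself, the first
  that \<open>p / q\<close> has a positive derivative on the real line. Multiplying by \<open>\<bar>q\<bar>\<^sup>2\<close>
  and \<open>q\<^sup>2\<close> respectively keeps both meaningful at zeros of \<open>q\<close>, so that they also assert that
  \<open>p\<close> and \<open>q\<close> have no common real zero and no zero at all in the upper half-plane.\<close>

definition nevanlinna_pair :: "real poly \<Rightarrow> real poly \<Rightarrow> bool" where
  "nevanlinna_pair p q \<longleftrightarrow>
     (\<forall>x. wronskian p q x > 0) \<and> (\<forall>z. Im z > 0 \<longrightarrow> Im (cpoly p z * cnj (cpoly q z)) > 0)"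

lemma nevanlinna_pair_linear: "nevanlinna_pair [:a, 1:] 1"
  by (simp add: nevanlinna_pair_def wronskian_def pderiv_pCons map_poly_pCons)

text \<open>Both defining quantities of the new pair are those of the old one times \<open>c\<close>, plus a
  nonnegative square: \<open>h q\<^sup>2\<close> for the Wronskian and \<open>h Im z \<bar>q\<bar>\<^sup>2\<close> for the imaginary part.
  The constant \<open>a\<close> cancels from either.\<close>

lemma nevanlinna_pair_step:
  assumes qr: "nevanlinna_pair q r" and "h \<ge> 0" "c > 0"
  shows "nevanlinna_pair ([:a, h:] * q - smult c r) q"
  unfolding nevanlinna_pair_def
proof (intro conjI allI impI)
  fix x
  let ?p = "[:a, h:] * q - smult c r"
  have "wronskian ?p q x = h * (poly q x)\<^sup>2 + c * wronskian q r x"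
    by (simp add: wronskian_def pderiv_mult pderiv_diff pderiv_add pderiv_smult
        pderiv_pCons algebra_simps power2_eq_square)
  moreover have "wronskian q r x > 0"
    using qr by (simp add: nevanlinna_pair_def)
  ultimately show "wronskian ?p q x > 0"
    using assms by (simp add: add_nonneg_pos)
next
  fix z :: complex
  assume z: "Im z > 0"
  let ?p = "[:a, h:] * q - smult c r"
  have p: "cpoly ?p z = (of_real a + of_real h * z) * cpoly q z - of_real c * cpoly r z"
    by (simp add: cpoly_diff cpoly_smult cpoly_add cpoly_pCons algebra_simps)
  have "Im (cpoly ?p z * cnj (cpoly q z)) =
      h * Im z * (cmod (cpoly q z))\<^sup>2 + c * Im (cpoly q z * cnj (cpoly r z))"
    unfolding p cmod_power2 by (simp add: algebra_simps power2_eq_square)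
  moreover have "Im (cpoly q z * cnj (cpoly r z)) > 0"
    using qr z by (simp add: nevanlinna_pair_def)
  ultimately show "Im (cpoly ?p z * cnj (cpoly q z)) > 0"
    using assms z by (simp add: add_nonneg_pos)
qed

lemma nevanlinna_pair_nonzero_upper:
  assumes "nevanlinna_pair p q" "Im z > 0"
  shows "cpoly p z \<noteq> 0" "cpoly q z \<noteq> 0"
  using assms by (auto simp: nevanlinna_pair_def)

lemma nevanlinna_pair_interlacing:
  assumes "nevanlinna_pair p q"
  shows "only_simple_real_zeros p" "only_simple_real_zeros q" "zeros_interlace q p"
proof -
  have W: "wronskian p q x \<noteq> 0" for x
    using assms by (metis less_irrefl nevanlinna_pair_def)
  have "poly (pderiv p) x \<noteq> 0" if "poly p x = 0" for x
    using W[of x] that by (auto simp: wronskian_def)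
  then show "only_simple_real_zeros p"
    using nevanlinna_pair_nonzero_upper[OF assms] by (intro only_simple_real_zerosI) auto
  have "poly (pderiv q) x \<noteq> 0" if "poly q x = 0" for x
    using W[of x] that by (auto simp: wronskian_def)
  then show "only_simple_real_zeros q"
    using nevanlinna_pair_nonzero_upper[OF assms] by (intro only_simple_real_zerosI) auto
  have "wronskian q p x \<noteq> 0" for x
    using W[of x] by (simp add: wronskian_swap[of q p])
  then show "zeros_interlace q p"
    by (rule zeros_interlaceI)
qed

section \<open>The polynomials R as associated polynomials\<close>

lemma alpha_shift: "alpha (l + 1) \<eta> n = alpha l \<eta> (Suc n)"
  by (simp add: alpha_def algebra_simps)

lemma beta_shift: "beta (l + 1) \<eta> n = beta l \<eta> (Suc n)"
  by (simp add: beta_def algebra_simps)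

lemma beta_pos:
  assumes "l > - 3 / 2" "n \<ge> 1"
  shows "beta l \<eta> n > 0"
proof -
  have "real n \<ge> 1"
    using assms by simp
  then have "2 * l + 2 * real n + 1 > 0" "l + real n + 1 > 0"
    using assms by linarith+
  then show ?thesis
    unfolding beta_def
    by (intro divide_pos_pos mult_pos_pos pochhammer_pos
        add_pos_nonneg[of "(l + real n + 1)\<^sup>2"]) auto
qed

lemma R_Suc_0: "R (Suc 0) l \<eta> = [:- alpha l \<eta> 0, 1:]"
  by (simp add: alpha_def)

text \<open>The defining recurrence builds \<open>R\<close> up at the last index; here it is unrolled at the first
  one. Both are expansions of the same tridiagonal determinant, and they agree because the
  right-hand side, as a sequence in \<open>n\<close>, satisfies the defining recurrence too.\<close>

lemma R_first_row:
  "R (Suc (Suc n)) l \<eta> =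
     [:- alpha l \<eta> 0, 1:] * R (Suc n) (l + 1) \<eta> - smult (beta l \<eta> 1) (R n (l + 1 + 1) \<eta>)"
proof (induction n rule: less_induct)
  case (less n)
  consider "n = 0" | "n = 1" | m where "n = Suc (Suc m)"
    by (metis One_nat_def not0_implies_Suc)
  then show ?case
  proof cases
    case 1
    show ?thesis
      unfolding 1 R.simps(3) R_Suc_0 R.simps(1) alpha_shift by (simp add: algebra_simps)
  next
    case 2
    show ?thesis
      unfolding 2 One_nat_def R.simps(3) R_Suc_0 R.simps(1) alpha_shift beta_shift
      by (simp add: algebra_simps)
  next
    case 3
    have first_and_last_row_commute:
      "v * (a * p - smult b r) - smult c (a * q - smult b s) =
         a * (v * p - smult c q) - smult b (v * r - smult c s)"
      for a v p q r s :: "real poly" and b c :: real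
      by (simp add: algebra_simps smult_diff_right)
    have step: "R (Suc (Suc n)) l \<eta> = [:- alpha l \<eta> (Suc n), 1:] * R (Suc (Suc (Suc m))) l \<eta>
        - smult (beta l \<eta> (Suc n)) (R (Suc (Suc m)) l \<eta>)"
      by (simp only: 3 R.simps(3))
    have "Suc m < n" "m < n"
      by (simp_all add: 3)
    note IH = this[THEN less.IH]
    show ?thesis
      unfolding step IH
      unfolding 3 R.simps(3)[of "Suc m" "l + 1"] R.simps(3)[of m "l + 1 + 1"]
        alpha_shift beta_shift
      by (rule first_and_last_row_commute)
  qed
qed

lemma nevanlinna_pair_R:
  assumes "l > - 3 / 2"
  shows "nevanlinna_pair (R (Suc n) l \<eta>) (R n (l + 1) \<eta>)"
  using assms
proof (induction n arbitrary: l)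
  case 0
  show ?case
    unfolding R_Suc_0 R.simps(1) by (rule nevanlinna_pair_linear)
next
  case (Suc n)
  have "nevanlinna_pair (R (Suc n) (l + 1) \<eta>) (R n (l + 1 + 1) \<eta>)"
    using Suc.prems by (intro Suc.IH) simp
  then show ?case
    unfolding R_first_row using Suc.prems by (intro nevanlinna_pair_step beta_pos) auto
qed

section \<open>Interlacing of R and D\<close>

theorem theorem5p1:
  fixes l \<eta> H :: real and n :: nat
  assumes "l > - 3 / 2" and "l \<noteq> - 1" and "\<eta> \<noteq> 0" and "n \<ge> 1" and "H \<ge> 0"
  shows "only_simple_real_zeros (R n l \<eta>) \<and> only_simple_real_zeros (D n l \<eta> H) \<and>
         zeros_interlace (R n l \<eta>) (D n l \<eta> H)"
proof -
  obtain m where n: "n = Suc m"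
    using \<open>n \<ge> 1\<close> by (cases n) auto
  have "(1 + \<eta>\<^sup>2 / (l + 1)\<^sup>2) / (4 * (2 * l + 3)) > 0"
    using \<open>l > - 3 / 2\<close> by (intro divide_pos_pos add_pos_nonneg) auto
  then have "nevanlinna_pair (D n l \<eta> H) (R n l \<eta>)"
    unfolding D_def n diff_Suc_1
    by (intro nevanlinna_pair_step nevanlinna_pair_R assms)
  then show ?thesis
    using nevanlinna_pair_interlacing by blast
qed

end
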